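(* Let $A\in\mathbb{C}^{q\times n}$ with $\mathrm{rank}(A)=r_1$ and $W\in\mathbb{C}^{n\times q}$, $W\neq 0$, with $\mathrm{rank}(W)=r_2$, and let $$A=T\begin{pmatrix}\Sigma_1&0\\0&0\end{pmatrix}U^*,\qquad W=S\begin{pmatrix}\Sigma_2&0\\0&0\end{pmatrix}V^*$$ be singular value decompositions, where $T,V\in\mathbb{C}^{q\times q}$ and $U,S\in\mathbb{C}^{n\times n}$ are unitary and $\Sigma_1\in\mathbb{C}^{r_1\times r_1}$, $\Sigma_2\in\mathbb{C}^{r_2\times r_2}$ are nonsingular. Partition $$U^*S=\begin{pmatrix}K_1&L_1\\H_1&R_1\end{pmatrix},\qquad V^*T=\begin{pmatrix}K_2&L_2\\H_2&R_2\end{pmatrix}$$ with $K_1\in\mathbb{C}^{r_1\times r_2}$, $L_1\in\mathbb{C}^{r_1\times(n-r_2)}$, $H_1\in\mathbb{C}^{(n-r_1)\times r_2}$, $R_1\in\mathbb{C}^{(n-r_1)\times(n-r_2)}$, $K_2\in\mathbb{C}^{r_2\times r_1}$, $L_2\in\mathbb{C}^{r_2\times(q-r_1)}$, $H_2\in\mathbb{C}^{(q-r_2)\times r_1}$, $R_2\in\mathbb{C}^{(q-r_2)\times(q-r_1)}$, so that $$A=T\begin{pmatrix}\Sigma_1K_1&\Sigma_1L_1\\0&0\end{pmatrix}S^*,\qquad W=S\begin{pmatrix}\Sigma_2K_2&\Sigma_2L_2\\0&0\end{pmatrix}T^*.$$ Let $m$ be a positive integer. Then $$A^{\mathrm{wg}_m,W}=T\begin{pmatrix}(\Sigma_1K_1)^{\mathrm{wg}_m,\Sigma_2K_2}&B\\0&0\end{pmatrix}S^*,$$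 where $$B=(\Sigma_1K_1)^{\mathrm{cEP},\Sigma_2K_2}\left(\Sigma_2K_2(\Sigma_1K_1)^{\mathrm{cEP},\Sigma_2K_2}\right)^{m}(\Sigma_2K_2\Sigma_1K_1)^{m-1}\Sigma_2K_2\Sigma_1L_1.$$ Here $C^{\mathrm{cEP},Z}$ and $C^{\mathrm{wg}_m,Z}$ denote the weighted core-EP inverse and the $Z$-weighted $m$-weak group inverse of $C$ with weight $Z$.
   Context: Notation: $B^*$ is the conjugate transpose and $\mathcal{R}(B)$ the range (column space) of $B$. For square $B$, $B^0=I$ and $\mathrm{Ind}(B)$ is the smallest integer $j\ge 0$ with $\mathrm{rank}(B^{j})=\mathrm{rank}(B^{j+1})$. $P_{\mathcal{T}}$ is the orthogonal projector onto the subspace $\mathcal{T}$. Let $C\in\mathbb{C}^{a\times b}$ and $Z\in\mathbb{C}^{b\times a}$ (the weight), and put $k_C=\max\{\mathrm{Ind}(CZ),\mathrm{Ind}(ZC)\}$. - $Z$-product: for $X,Y\in\mathbb{C}^{a\times b}$, $X\star Y=XZY$, and $X^{\star l}=X\star\cdots\star X$ ($l$ factors) for $l\ge 1$. - Weighted core-EP inverse: $C^{\mathrm{cEP},Z}\in\mathbb{C}^{a\times b}$ is the unique matrix $X$ with $ZCZX=P_{\mathcal{R}((ZC)^{k_C})}$ and $\mathcal{R}(X)\subseteq\mathcal{R}((CZ)^{k_C})$ (existence and uniqueness are known). - $Z$-weighted $m$-weak group inverse: $C^{\mathrm{wg}_m,Z}=(C^{\mathrm{cEP},Z})^{\star(m+1)}\,Z\,C^{\star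 m}$, the $\star$-powers being taken with respect to $Z$. The weight $\Sigma_2K_2$ occurring in the statement may be the zero matrix; the same definitions are then used verbatim, and both inverses are zero. *)

theory Defs
  imports Complex_Main "Jordan_Normal_Form.DL_Rank" "Jordan_Normal_Form.Schur_Decomposition"
begin

abbreviation mat_rank :: "complex mat \<Rightarrow> nat" where
  "mat_rank B \<equiv> vec_space.rank (dim_row B) B"

abbreviation mat_range :: "complex mat \<Rightarrow> complex vec set" where
  "mat_range B \<equiv> vec_space.col_space (dim_row B) B"

definition unitary_mat :: "nat \<Rightarrow> complex mat \<Rightarrow> bool" where
  "unitary_mat n U \<longleftrightarrow> U \<in> carrier_mat n n \<and>
     mat_adjoint U * U = 1\<^sub>m n \<and> U * mat_adjoint U = 1\<^sub>m n"

definition mat_index :: "complex mat \<Rightarrow> nat" where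
  "mat_index B = (LEAST j. mat_rank (B ^\<^sub>m j) = mat_rank (B ^\<^sub>m (j + 1)))"

definition is_orth_projector :: "nat \<Rightarrow> complex vec set \<Rightarrow> complex mat \<Rightarrow> bool" where
  "is_orth_projector n \<T> P \<longleftrightarrow> P \<in> carrier_mat n n \<and>
     P * P = P \<and> mat_adjoint P = P \<and> mat_range P = \<T>"

definition orth_projector :: "nat \<Rightarrow> complex vec set \<Rightarrow> complex mat" where
  "orth_projector n \<T> = (THE P. is_orth_projector n \<T> P)"

text \<open>The compact part of a singular value decomposition: a square diagonal block of positive
  real numbers. No ordering of the singular values is imposed.\<close>

definition singular_value_block :: "nat \<Rightarrow> complex mat \<Rightarrow> bool" where
  "singular_value_block r \<Sigma> \<longleftrightarrow> \<Sigma> \<in> carrier_mat r r \<and> diagonal_mat \<Sigma> \<and>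
     (\<forall>i<r. \<exists>s::real. s > 0 \<and> \<Sigma> $$ (i, i) = complex_of_real s)"

text \<open>Here \<open>M\<close> has size \<open>p \<times> s\<close>; in the intended use \<open>r \<le> min p s\<close>, since \<open>r\<close> is
  the rank of \<open>M\<close>.\<close>

definition is_svd ::
  "nat \<Rightarrow> nat \<Rightarrow> nat \<Rightarrow> complex mat \<Rightarrow> complex mat \<Rightarrow> complex mat \<Rightarrow> complex mat \<Rightarrow> bool" where
  "is_svd p s r M X \<Sigma> Y \<longleftrightarrow> unitary_mat p X \<and> unitary_mat s Y \<and> singular_value_block r \<Sigma> \<and>
     M = X * four_block_mat \<Sigma> (0\<^sub>m r (s - r)) (0\<^sub>m (p - r) r) (0\<^sub>m (p - r) (s - r))
           * mat_adjoint Y"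

text \<open>In all of the following the weight \<open>Z\<close> comes first; if \<open>C\<close> has size \<open>a \<times> b\<close>, then
  \<open>Z\<close> is supposed to have size \<open>b \<times> a\<close>.\<close>

definition weighted_prod :: "complex mat \<Rightarrow> complex mat \<Rightarrow> complex mat \<Rightarrow> complex mat" where
  "weighted_prod Z X Y = X * Z * Y"

text \<open>The weighted product has no unit in general, so the zeroth power is left unspecified.\<close>

fun weighted_pow :: "complex mat \<Rightarrow> complex mat \<Rightarrow> nat \<Rightarrow> complex mat" where
  "weighted_pow Z X (Suc 0) = X"
| "weighted_pow Z X (Suc (Suc l)) = weighted_prod Z (weighted_pow Z X (Suc l)) X"

definition weighted_index :: "complex mat \<Rightarrow> complex mat \<Rightarrow> nat" where
  "weighted_index Z C = max (mat_index (C * Z)) (mat_index (Z * C))"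

definition is_weighted_core_EP :: "complex mat \<Rightarrow> complex mat \<Rightarrow> complex mat \<Rightarrow> bool" where
  "is_weighted_core_EP Z C X \<longleftrightarrow> X \<in> carrier_mat (dim_row C) (dim_col C) \<and>
     Z * C * Z * X = orth_projector (dim_col C) (mat_range ((Z * C) ^\<^sub>m weighted_index Z C)) \<and>
     mat_range X \<subseteq> mat_range ((C * Z) ^\<^sub>m weighted_index Z C)"

definition weighted_core_EP :: "complex mat \<Rightarrow> complex mat \<Rightarrow> complex mat" where
  "weighted_core_EP Z C = (THE X. is_weighted_core_EP Z C X)"

definition weighted_weak_group :: "nat \<Rightarrow> complex mat \<Rightarrow> complex mat \<Rightarrow> complex mat" where
  "weighted_weak_group m Z C =
     weighted_pow Z (weighted_core_EP Z C) (m + 1) * Z * weighted_pow Z C m"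

end

theory Submission
  imports Defs
begin

text \<open>
  Write \<open>T1\<close>, \<open>U1\<close> for the first \<open>r\<^sub>1\<close> columns of \<open>T\<close>, \<open>U\<close> and \<open>S1\<close>, \<open>V1\<close> for the first \<open>r\<^sub>2\<close>
  columns of \<open>S\<close>, \<open>V\<close>. The singular value decompositions in compact form are \<open>A = T1 F\<close> and
  \<open>W = S1 G\<close> with \<open>F = \<Sigma>\<^sub>1 U1\<^sup>*\<close> and \<open>G = \<Sigma>\<^sub>2 V1\<^sup>*\<close>, where \<open>T1\<close> and \<open>S1\<close> are isometries. The blocks of
  the theorem appear when the outer factors meet:
  \<open>F S1 = \<Sigma>\<^sub>1 K\<^sub>1\<close>, \<open>F S2 = \<Sigma>\<^sub>1 L\<^sub>1\<close> and \<open>G T1 = \<Sigma>\<^sub>2 K\<^sub>2\<close>, with \<open>S2\<close> the remaining columns of \<open>S\<close>.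

  Put \<open>C = F S1\<close> and \<open>Z = G T1\<close>. Any alternating product of \<open>A\<close> and \<open>W\<close> collapses to a product of
  \<open>C\<close> and \<open>Z\<close> between an isometry on the left and \<open>F\<close> or \<open>G\<close> on the right. For high powers the
  range depends only on the left part, so \<open>R((W A)\<^sup>j)\<close> is the image under \<open>S1\<close> of \<open>R((Z C)\<^sup>j)\<close>, and
  an isometry carries orthogonal projectors to orthogonal projectors. Therefore the
  core-EP inverse of \<open>A\<close> with weight \<open>W\<close> is \<open>T1 X S1\<^sup>*\<close>, where \<open>X\<close> is that of \<open>C\<close> with weight \<open>Z\<close>
  (\<open>weighted_core_EP_dilation\<close>). Substituting this in the definition gives the weak group inverse
  \<open>T1 N F\<close> with \<open>N = X (Z X)\<^sup>m Z (C Z)\<^sup>m\<^sup>-\<^sup>1\<close> (\<open>weighted_weak_group_dilation\<close>), and expanding \<open>F\<close> in the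
  unitary basis \<open>S\<close> (\<open>left_cols_mult_eq_block\<close>) yields the two blocks \<open>N C\<close> and \<open>N \<Sigma>\<^sub>1 L\<^sub>1\<close>.

  The inverses and projectors are defined by definite descriptions, so existence and uniqueness
  are proved as well (\<open>orth_projector_correct\<close>, \<open>weighted_core_EP_correct\<close>). For projectors, existence
  comes from the formula \<open>Q (Q\<^sup>* Q)\<^sup>-\<^sup>1 Q\<^sup>*\<close> with the columns of \<open>Q\<close> a basis of the subspace. For the core-EP
  inverse, everything rests on the fact that from the index on, the ranges and the kernels of the powers of a
  square matrix no longer change (\<open>pow_range_stable\<close>, \<open>pow_kernel_stable\<close>).
\<close>

section \<open>Ranges and ranks of complex matrices\<close>

text \<open>Associativity with dimension equations as side conditions, so that the simplifier can bracket
  every product to the right.\<close>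

lemma mult_assoc_dims:
  fixes A B C :: "complex mat"
  shows "dim_col A = dim_row B \<Longrightarrow> dim_col B = dim_row C \<Longrightarrow> A * B * C = A * (B * C)"
  by (rule assoc_mult_mat) auto

text \<open>A basis of the subspace is independent in the whole space, and by the equality of dimensions it
  is large enough to be a basis there as well.\<close>

lemma subspace_eq_carrier_if_dim_eq:
  assumes "vectorspace K V" "VectorSpace.subspace K U V" "vectorspace.fin_dim K V"
    "vectorspace.fin_dim K (V\<lparr>carrier := U\<rparr>)"
    "vectorspace.dim K (V\<lparr>carrier := U\<rparr>) = vectorspace.dim K V"
  shows "U = carrier V"
proof -
  interpret vectorspace K V by fact
  have vsU: "vectorspace K (vs U)" using assms(2) subspace_is_vs by auto
  then interpret U: vectorspace K "vs U" .
  have subU: "U \<subseteq> carrier V" and smU: "submodule K U V"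
    using assms(2) by (auto simp: VectorSpace.subspace_def submodule_def)
  obtain b where b: "finite b" "U.basis b" using U.finite_basis_exists assms(4) by blast
  hence bU: "b \<subseteq> U" "U.lin_indpt b" by (auto simp: U.basis_def)
  have li: "lin_indpt b" using span_li_not_depend(2)[OF bU(1) smU] bU by auto
  have "card b = U.dim" using U.dim_basis b by simp
  hence "basis b" using assms(3,5) b(1) bU subU li dim_li_is_basis[of b] by auto
  hence "carrier V = span b" by (auto simp: basis_def)
  also have "\<dots> \<subseteq> U" using span_is_subset[OF bU(1) smU] .
  finally show ?thesis using subU by auto
qed

text \<open>Turns range inclusions into matrix factorizations. Every later argument about ranges is then
  a computation with products; the columns of \<open>Y\<close> are preimages of the columns of \<open>M\<close>.\<close>

lemma mat_range_subset_iff: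
  assumes M: "M \<in> carrier_mat n a" and N: "N \<in> carrier_mat n b"
  shows "mat_range M \<subseteq> mat_range N \<longleftrightarrow> (\<exists>Y \<in> carrier_mat b a. M = N * Y)"
proof
  assume sub: "mat_range M \<subseteq> mat_range N"
  have "\<exists>x. x \<in> carrier_vec b \<and> N *\<^sub>v x = col M j" if j: "j < a" for j
  proof -
    have "col M j \<in> mat_range M"
      using M j by (auto simp: vec_space.col_space_eq[OF M] intro!: bexI[of _ "unit_vec a j"])
    with sub show ?thesis using M N by (auto simp: vec_space.col_space_eq[OF N])
  qed
  then obtain f where f: "\<And>j. j < a \<Longrightarrow> f j \<in> carrier_vec b \<and> N *\<^sub>v f j = col M j" by metis
  define Y where "Y = mat_of_cols b (map f [0..<a])"
  have Y: "Y \<in> carrier_mat b a" by (auto simp: Y_def intro!: carrier_matI)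
  moreover have "M = N * Y"
  proof (rule mat_col_eqI)
    fix j assume "j < dim_col (N * Y)"
    hence j: "j < a" using Y by simp
    have "col (N * Y) j = N *\<^sub>v col Y j" using col_mult2[OF N Y j] .
    also have "col Y j = f j" using j f unfolding Y_def by (subst col_mat_of_cols) auto
    finally show "col M j = col (N * Y) j" using f j by simp
  qed (use M N Y in auto)
  ultimately show "\<exists>Y \<in> carrier_mat b a. M = N * Y" by blast
next
  assume "\<exists>Y \<in> carrier_mat b a. M = N * Y"
  then obtain Y where Y: "Y \<in> carrier_mat b a" and eq: "M = N * Y" by blast
  show "mat_range M \<subseteq> mat_range N"
  proof
    fix v assume "v \<in> mat_range M"
    then obtain x where x: "x \<in> carrier_vec a" "v = M *\<^sub>v x" "v \<in> carrier_vec n"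
      using M by (auto simp: vec_space.col_space_eq[OF M])
    hence "v = N *\<^sub>v (Y *\<^sub>v x)" using eq N Y by simp
    moreover have "Y *\<^sub>v x \<in> carrier_vec b" using Y x by simp
    ultimately show "v \<in> mat_range N" using N x by (auto simp: vec_space.col_space_eq[OF N])
  qed
qed

text \<open>Connects the rank with the dimension of the range as a subspace, which is the form in which the
  dimension arguments of abstract vector spaces apply.\<close>

lemma mat_range_subspace:
  fixes M :: "complex mat"
  assumes M: "M \<in> carrier_mat n a"
  shows "VectorSpace.subspace class_ring (mat_range M) (module_vec TYPE(complex) n)"
    "vectorspace.fin_dim class_ring (module_vec TYPE(complex) n\<lparr>carrier := mat_range M\<rparr>)"
    "mat_rank M = vectorspace.dim class_ring (module_vec TYPE(complex) n\<lparr>carrier := mat_range M\<rparr>)"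
proof -
  interpret vec_space "TYPE(complex)" n .
  have c: "set (cols M) \<subseteq> carrier_vec n" using M cols_dim by blast
  show "VectorSpace.subspace class_ring (mat_range M) (module_vec TYPE(complex) n)"
    using M c span_is_subspace by (auto simp: col_space_def)
  show "vectorspace.fin_dim class_ring (module_vec TYPE(complex) n\<lparr>carrier := mat_range M\<rparr>)"
    using M fin_dim_span_cols[OF M] by (simp add: col_space_def)
  show "mat_rank M = vectorspace.dim class_ring (module_vec TYPE(complex) n\<lparr>carrier := mat_range M\<rparr>)"
    using M by (simp add: col_space_def rank_def)
qed

text \<open>The range of \<open>A * B\<close> lies in that of \<open>A\<close>, and equal dimensions force equal ranges.\<close>

lemma mat_rank_mult_le:
  assumes A: "A \<in> carrier_mat n a" and B: "B \<in> carrier_mat a b"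
  shows "mat_rank (A * B) \<le> mat_rank A"
    and "mat_rank (A * B) = mat_rank A \<Longrightarrow> \<exists>Y \<in> carrier_mat b a. A = A * B * Y"
proof -
  interpret vec_space "TYPE(complex)" n .
  have AB: "A * B \<in> carrier_mat n b" using A B by simp
  have sub: "mat_range (A * B) \<subseteq> mat_range A"
    using mat_range_subset_iff[OF AB A] B by blast
  note fA = mat_range_subspace[OF A] and fAB = mat_range_subspace[OF AB]
  have vsA: "vectorspace class_ring (vs (mat_range A))" using subspace_is_vs fA(1) by blast
  have nest: "VectorSpace.subspace class_ring (mat_range (A * B)) (vs (mat_range A))"
    using nested_subspaces[OF fA(1) fAB(1) sub] .
  show "mat_rank (A * B) \<le> mat_rank A"
    using vectorspace.subspace_dim[OF vsA nest fA(2)] fAB(2,3) fA(3) by simp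
  assume "mat_rank (A * B) = mat_rank A"
  hence "mat_range (A * B) = carrier (vs (mat_range A))"
    by (intro subspace_eq_carrier_if_dim_eq[OF vsA nest fA(2)]) (use fAB fA in auto)
  hence "mat_range A \<subseteq> mat_range (A * B)" by simp
  thus "\<exists>Y \<in> carrier_mat b a. A = A * B * Y" using mat_range_subset_iff[OF A AB] by blast
qed

lemma mat_rank_le:
  assumes A: "A \<in> carrier_mat n a"
  shows "mat_rank A \<le> n" "mat_rank A \<le> a"
proof -
  interpret vec_space "TYPE(complex)" n .
  note fA = mat_range_subspace[OF A]
  show "mat_rank A \<le> n" using subspace_dim[OF fA(1) _ fA(2)] fA(3) dim_is_n by simp
  show "mat_rank A \<le> a" using rank_le_nc[OF A] A by simp
qed

lemma range_basis_columns:
  assumes M: "M \<in> carrier_mat n a"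
  obtains r Q where "Q \<in> carrier_mat n r" "mat_range Q = mat_range M"
    "\<And>v. v \<in> carrier_vec r \<Longrightarrow> Q *\<^sub>v v = 0\<^sub>v n \<Longrightarrow> v = 0\<^sub>v r"
proof -
  interpret vec_space "TYPE(complex)" n .
  let ?R = "mat_range M"
  note f = mat_range_subspace[OF M]
  have vsR: "vectorspace class_ring (vs ?R)" using subspace_is_vs f(1) by blast
  then interpret R: vectorspace class_ring "vs ?R" .
  have sm: "submodule class_ring ?R V" and Rc: "?R \<subseteq> carrier V"
    using f(1) by (auto simp: VectorSpace.subspace_def submodule_def)
  obtain b where b: "finite b" "R.basis b" using R.finite_basis_exists f(2) by blast
  hence bR: "b \<subseteq> ?R" "R.lin_indpt b" "R.span b = ?R" by (auto simp: R.basis_def)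
  have li: "lin_indpt b" and sp: "span b = ?R"
    using span_li_not_depend[OF bR(1) sm] bR by auto
  obtain bs where bs: "set bs = b" "distinct bs" using b(1) finite_distinct_list by blast
  have bsc: "set bs \<subseteq> carrier_vec n" using bs bR Rc by auto
  define Q where "Q = mat_of_cols n bs"
  have Q: "Q \<in> carrier_mat n (length bs)" by (auto simp: Q_def intro!: carrier_matI)
  have colsQ: "cols Q = bs" using bsc by (simp add: Q_def)
  show ?thesis
  proof (rule that[OF Q])
    show "mat_range Q = ?R" using Q sp colsQ bs by (simp add: col_space_def)
    fix v assume "v \<in> carrier_vec (length bs)" "Q *\<^sub>v v = 0\<^sub>v n"
    thus "v = 0\<^sub>v (length bs)" using lin_depI[OF Q] colsQ bs li by auto
  qed
qed

section \<open>Adjoints and orthogonal projectors\<close>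

lemma mat_adjoint_dim [simp]:
  "dim_row (mat_adjoint A) = dim_col A" "dim_col (mat_adjoint A) = dim_row A"
  by (simp_all add: mat_adjoint_def)

lemma mat_adjoint_carrier [simp]:
  "A \<in> carrier_mat n m \<Longrightarrow> mat_adjoint A \<in> carrier_mat m n"
  by (auto intro!: carrier_matI)

lemma mat_adjoint_index [simp]:
  fixes A :: "complex mat"
  shows "i < dim_col A \<Longrightarrow> j < dim_row A \<Longrightarrow> mat_adjoint A $$ (i, j) = cnj (A $$ (j, i))"
  by (simp add: mat_adjoint_def mat_of_rows_index)

lemma mat_adjoint_adjoint [simp]: "mat_adjoint (mat_adjoint A) = (A :: complex mat)"
  by (rule eq_matI) auto

lemma mat_adjoint_mult:
  fixes A B :: "complex mat"
  assumes "dim_col A = dim_row B"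
  shows "mat_adjoint (A * B) = mat_adjoint B * mat_adjoint A"
  by (rule eq_matI) (use assms in \<open>auto simp: scalar_prod_def mult.commute intro!: sum.cong\<close>)

text \<open>The squared norm of \<open>M v\<close> is the inner product of \<open>M\<^sup>* M v\<close> with \<open>v\<close>.\<close>

lemma adjoint_mult_vec_eq_zero_imp:
  fixes M :: "complex mat"
  assumes M: "M \<in> carrier_mat n a" and v: "v \<in> carrier_vec a"
    and z: "mat_adjoint M *\<^sub>v (M *\<^sub>v v) = 0\<^sub>v a"
  shows "M *\<^sub>v v = 0\<^sub>v n"
proof -
  define u where "u = M *\<^sub>v v"
  have u: "u \<in> carrier_vec n" using M v by (simp add: u_def)
  have col0: "(\<Sum>i<n. cnj (M $$ (i, j)) * u $ i) = 0" if j: "j < a" for j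
    using arg_cong[OF z[folded u_def], of "\<lambda>w. w $ j"] j M u
    by (simp add: scalar_prod_def atLeast0LessThan)
  have "u \<bullet>c u = (\<Sum>i<n. u $ i * cnj (u $ i))"
    using u by (simp add: scalar_prod_def atLeast0LessThan)
  also have "\<dots> = (\<Sum>i<n. u $ i * (\<Sum>j<a. cnj (M $$ (i, j)) * cnj (v $ j)))"
    using M v by (intro sum.cong) (auto simp: u_def scalar_prod_def atLeast0LessThan)
  also have "\<dots> = (\<Sum>j<a. cnj (v $ j) * (\<Sum>i<n. cnj (M $$ (i, j)) * u $ i))"
    unfolding sum_distrib_left by (subst sum.swap) (simp add: mult_ac)
  also have "\<dots> = 0" using col0 by simp
  finally show ?thesis using conjugate_square_eq_0_vec[OF u] by (simp add: u_def)
qed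

text \<open>Take for the columns of \<open>Q\<close> a basis of the range of \<open>M\<close>. Then \<open>Q\<^sup>* Q\<close> is injective, hence
  invertible, and \<open>L = (Q\<^sup>* Q)\<^sup>-\<^sup>1 Q\<^sup>*\<close> is the Moore-Penrose inverse of \<open>Q\<close>: the matrix \<open>Q * L\<close> is
  the orthogonal projector onto the range, and \<open>L\<close> reads off coordinates in the chosen basis.\<close>

lemma range_coordinates:
  assumes M: "M \<in> carrier_mat n a"
  obtains r Q L where "Q \<in> carrier_mat n r" "L \<in> carrier_mat r n" "mat_range Q = mat_range M"
    "L * Q = 1\<^sub>m r" "mat_adjoint (Q * L) = Q * L"
proof -
  obtain r Q where Q: "Q \<in> carrier_mat n r" and ran: "mat_range Q = mat_range M"
    and inj: "\<And>v. v \<in> carrier_vec r \<Longrightarrow> Q *\<^sub>v v = 0\<^sub>v n \<Longrightarrow> v = 0\<^sub>v r"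
    using range_basis_columns[OF M] by metis
  define H where "H = mat_adjoint Q * Q"
  have H: "H \<in> carrier_mat r r" using Q by (intro carrier_matI) (simp_all add: H_def)
  have Hadj: "mat_adjoint H = H" using Q by (simp add: H_def mat_adjoint_mult)
  have "det H \<noteq> 0"
  proof
    assume "det H = 0"
    then obtain v where v: "v \<in> carrier_vec r" "v \<noteq> 0\<^sub>v r" "H *\<^sub>v v = 0\<^sub>v r"
      using det_0_iff_vec_prod_zero_field[OF H] by blast
    have "mat_adjoint Q *\<^sub>v (Q *\<^sub>v v) = 0\<^sub>v r"
      using v(3) unfolding H_def assoc_mult_mat_vec[OF mat_adjoint_carrier[OF Q] Q v(1)] .
    thus False using adjoint_mult_vec_eq_zero_imp[OF Q v(1)] inj v by blast
  qed
  then obtain N where N: "N \<in> carrier_mat r r" "N * H = 1\<^sub>m r" "H * N = 1\<^sub>m r"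
    using det_non_zero_imp_unit[OF H, of "()"] unfolding Units_def by (auto simp: ring_mat_def)
  note d = carrier_matD[OF Q] carrier_matD[OF H] carrier_matD[OF N(1)]
  \<comment> \<open>The inverse of the Hermitian matrix \<open>H\<close> is Hermitian.\<close>
  have "mat_adjoint N * H = mat_adjoint (H * N)" using Hadj by (simp add: mat_adjoint_mult d)
  also have "\<dots> = 1\<^sub>m r" unfolding N(3) by (rule eq_matI) auto
  finally have "mat_adjoint N * H * N = N" using N by simp
  hence Nadj: "mat_adjoint N = N" using N(3) N(1) by (simp add: mult_assoc_dims d)
  define L where "L = N * mat_adjoint Q"
  have L: "L \<in> carrier_mat r n" by (intro carrier_matI) (simp_all add: L_def d)
  show ?thesis
  proof (rule that[OF Q L ran])
    show "L * Q = 1\<^sub>m r" using N(2) by (simp add: L_def H_def mult_assoc_dims d)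
    show "mat_adjoint (Q * L) = Q * L"
      using Nadj by (simp add: L_def mat_adjoint_mult mult_assoc_dims d)
  qed
qed

lemma orth_projector_exists:
  assumes M: "M \<in> carrier_mat n a"
  shows "\<exists>P. is_orth_projector n (mat_range M) P"
proof -
  obtain r Q L where Q: "Q \<in> carrier_mat n r" and L: "L \<in> carrier_mat r n"
    and ran: "mat_range Q = mat_range M" and LQ: "L * Q = 1\<^sub>m r"
    and adj: "mat_adjoint (Q * L) = Q * L"
    using range_coordinates[OF M] by metis
  note d = carrier_matD[OF Q] carrier_matD[OF L]
  have QL: "Q * L \<in> carrier_mat n n" using Q L by simp
  have QLQ: "Q * L * Q = Q" using LQ Q by (simp add: mult_assoc_dims d)
  have idem: "Q * L * (Q * L) = Q * L"
    using QLQ by (simp flip: mult_assoc_dims[of "Q * L" Q L] add: d)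
  have "mat_range (Q * L) \<subseteq> mat_range Q" using mat_range_subset_iff[OF QL Q] L by blast
  moreover have "mat_range Q \<subseteq> mat_range (Q * L)"
    using mat_range_subset_iff[OF Q QL] Q QLQ by metis
  ultimately show ?thesis using QL idem adj ran unfolding is_orth_projector_def by blast
qed

lemma orth_projector_absorb:
  assumes P: "is_orth_projector n S P" and M: "M \<in> carrier_mat n a" and "mat_range M \<subseteq> S"
  shows "P * M = M"
proof -
  have Pc: "P \<in> carrier_mat n n" and PP: "P * P = P" and "mat_range P = S"
    using P by (auto simp: is_orth_projector_def)
  then obtain Y where Y: "Y \<in> carrier_mat n a" "M = P * Y"
    using mat_range_subset_iff[OF M Pc] assms(3) by blast
  have "P * (P * Y) = P * P * Y" using Pc Y(1) by simp
  thus ?thesis using Y(2) PP by simp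
qed

text \<open>If \<open>P\<close> and \<open>Q\<close> have the same range, then \<open>P * Q = Q\<close> and \<open>Q * P = P\<close>; these two
  products are adjoint to each other.\<close>

lemma orth_projector_unique:
  assumes P: "is_orth_projector n S P" and Q: "is_orth_projector n S Q"
  shows "P = Q"
proof -
  have Pc: "P \<in> carrier_mat n n" "mat_adjoint P = P" "mat_range P = S"
    and Qc: "Q \<in> carrier_mat n n" "mat_adjoint Q = Q" "mat_range Q = S"
    using P Q by (auto simp: is_orth_projector_def)
  have "Q = mat_adjoint (P * Q)" using orth_projector_absorb[OF P Qc(1)] Qc by simp
  also have "\<dots> = Q * P" using Pc Qc by (simp add: mat_adjoint_mult)
  also have "\<dots> = P" using orth_projector_absorb[OF Q Pc(1)] Pc by simp
  finally show ?thesis by simp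
qed

lemma orth_projector_eqI: "is_orth_projector n S P \<Longrightarrow> orth_projector n S = P"
  unfolding orth_projector_def using orth_projector_unique by blast

lemma orth_projector_correct:
  assumes M: "M \<in> carrier_mat n a"
  shows "is_orth_projector n (mat_range M) (orth_projector n (mat_range M))"
  using orth_projector_exists[OF M] orth_projector_eqI by metis

section \<open>Powers beyond the index\<close>

lemma mat_pow_add:
  fixes B :: "complex mat"
  assumes "B \<in> carrier_mat n n"
  shows "B ^\<^sub>m (i + j) = B ^\<^sub>m i * B ^\<^sub>m j"
proof (induction j)
  case (Suc j)
  thus ?case using assms by (simp add: mult_assoc_dims carrier_matD[OF assms])
qed (use assms in simp)

text \<open>On a finite-dimensional space surjectivity implies injectivity. The hypothesis says that \<open>B\<close>
  maps the range of \<open>A\<close> onto a space containing that range, so \<open>B\<close> cannot annihilate a nonzero vector of the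
  range. In the coordinates of \<open>range_coordinates\<close> the map becomes a square matrix \<open>N'\<close> with right
  inverse \<open>N\<close>, and for square matrices a right inverse is a left inverse.\<close>

lemma mult_kernel_stable:
  fixes A B V Y :: "complex mat"
  assumes A: "A \<in> carrier_mat n a" and B: "B \<in> carrier_mat n n" and Y: "Y \<in> carrier_mat a a"
    and eq: "A = B * A * Y" and V: "V \<in> carrier_mat a c" and z: "B * A * V = 0\<^sub>m n c"
  shows "A * V = 0\<^sub>m n c"
proof -
  obtain r Q L where Q: "Q \<in> carrier_mat n r" and L: "L \<in> carrier_mat r n"
    and ran: "mat_range Q = mat_range A" and LQ: "L * Q = 1\<^sub>m r"
    using range_coordinates[OF A] by metis
  obtain R where R: "R \<in> carrier_mat r a" "A = Q * R"
    using mat_range_subset_iff[OF A Q] ran by blast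
  obtain S where S: "S \<in> carrier_mat a r" "Q = A * S"
    using mat_range_subset_iff[OF Q A] ran by blast
  note d = carrier_matD[OF A] carrier_matD[OF B] carrier_matD[OF Y] carrier_matD[OF V]
    carrier_matD[OF Q] carrier_matD[OF L] carrier_matD[OF R(1)] carrier_matD[OF S(1)]
  \<comment> \<open>\<open>N'\<close> is the compression of \<open>B\<close> to the range of \<open>A\<close> in coordinates, and \<open>N\<close> comes from \<open>A = B A Y\<close>.\<close>
  define N where "N = R * Y * S"
  define N' where "N' = L * B * Q"
  have N: "N \<in> carrier_mat r r" and N': "N' \<in> carrier_mat r r"
    using R S Q Y L B by (auto simp: N_def N'_def)
  have "N' * N = L * (B * (Q * R) * Y * S)" by (simp add: N_def N'_def mult_assoc_dims d)
  also have "\<dots> = 1\<^sub>m r" using LQ by (simp flip: R(2) eq S(2))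
  finally have NN': "N * N' = 1\<^sub>m r" by (rule mat_mult_left_right_inverse[OF N' N])
  have "N' * (R * V) = L * (B * (Q * R) * V)" by (simp add: N'_def mult_assoc_dims d)
  also have "\<dots> = 0\<^sub>m r c" using z L by (simp flip: R(2))
  finally have "N * (N' * (R * V)) = 0\<^sub>m r c" using N by simp
  moreover have "N * (N' * (R * V)) = N * N' * (R * V)"
    by (simp add: mult_assoc_dims d carrier_matD[OF N] carrier_matD[OF N'])
  ultimately have "R * V = 0\<^sub>m r c" using NN' R V by simp
  hence "Q * (R * V) = 0\<^sub>m n c" using Q by simp
  thus ?thesis using R(2) by (simp add: mult_assoc_dims d)
qed

text \<open>The ranks of the powers decrease, so they stall somewhere, and the index is the first such
  exponent. From there on the ranges of all higher powers coincide.\<close>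

lemma pow_range_stable:
  assumes B: "B \<in> carrier_mat n n" and k: "k \<ge> mat_index B"
  shows "\<exists>Y \<in> carrier_mat n n. B ^\<^sub>m k = B ^\<^sub>m (k + i) * Y"
proof -
  define f where "f = (\<lambda>j. mat_rank (B ^\<^sub>m j))"
  have Bp: "B ^\<^sub>m j \<in> carrier_mat n n" for j using B by simp
  have Suc_eq: "B ^\<^sub>m (Suc j) = B ^\<^sub>m j * B" for j by simp
  have dec: "f (Suc j) \<le> f j" for j
    unfolding f_def Suc_eq by (rule mat_rank_mult_le(1)[OF Bp B])
  have "\<exists>j. f j = f (j + 1)"
  proof (rule ccontr)
    assume "\<nexists>j. f j = f (j + 1)"
    hence "f (Suc j) < f j" for j using dec[of j] by (metis Suc_eq_plus1 le_neq_implies_less)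
    \<comment> \<open>Each step would lower the rank by at least one, which is impossible for more than \<open>f 0\<close> steps.\<close>
    hence dec1: "f (Suc j) + 1 \<le> f j" for j by (simp add: Suc_le_eq)
    have "f j + j \<le> f 0" for j
    proof (induction j)
      case (Suc j)
      thus ?case using dec1[of j] by linarith
    qed simp
    from this[of "Suc (f 0)"] show False by simp
  qed
  hence "f (mat_index B) = f (mat_index B + 1)"
    unfolding mat_index_def f_def by (rule LeastI_ex)
  then obtain Y where Y: "Y \<in> carrier_mat n n"
    "B ^\<^sub>m mat_index B = B ^\<^sub>m mat_index B * B * Y"
    using mat_rank_mult_le(2)[OF Bp[of "mat_index B"] B] by (auto simp: f_def)
  note d = carrier_matD[OF B] carrier_matD[OF Y(1)]
  have step: "B ^\<^sub>m l = B ^\<^sub>m (Suc l) * Y" if "l \<ge> mat_index B" for l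
  proof -
    have l: "l = (l - mat_index B) + mat_index B" using that by simp
    have "B ^\<^sub>m l = B ^\<^sub>m (l - mat_index B) * (B ^\<^sub>m mat_index B * B * Y)"
      by (subst l, subst mat_pow_add[OF B], subst Y(2)[symmetric]) simp
    also have "\<dots> = B ^\<^sub>m (l - mat_index B) * B ^\<^sub>m mat_index B * B * Y"
      using d by (simp add: mult_assoc_dims)
    finally show ?thesis using that by (simp flip: mat_pow_add[OF B])
  qed
  show ?thesis
  proof (induction i)
    case 0
    show ?case using B by (intro bexI[of _ "1\<^sub>m n"]) auto
  next
    case (Suc i)
    then obtain Y' where Y': "Y' \<in> carrier_mat n n" "B ^\<^sub>m k = B ^\<^sub>m (k + i) * Y'" by blast
    have "B ^\<^sub>m (k + i) = B ^\<^sub>m (k + Suc i) * Y"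
      unfolding add_Suc_right by (rule step) (use k in simp)
    hence "B ^\<^sub>m k = B ^\<^sub>m (k + Suc i) * Y * Y'" using Y'(2) by argo
    also have "\<dots> = B ^\<^sub>m (k + Suc i) * (Y * Y')"
      using B Y(1) Y'(1) by (intro assoc_mult_mat[of _ n n]) auto
    finally show ?case using Y(1) Y'(1) by (intro bexI[of _ "Y * Y'"]) auto
  qed
qed

text \<open>The ranges of \<open>B ^\<^sub>m k\<close> and \<open>B ^\<^sub>m (k + i)\<close> agree, so \<open>B ^\<^sub>m i\<close> maps this range onto
  itself and is therefore injective on it.\<close>

lemma pow_kernel_stable:
  assumes B: "B \<in> carrier_mat n n" and k: "k \<ge> mat_index B"
    and V: "V \<in> carrier_mat n c" and z: "B ^\<^sub>m (k + i) * V = 0\<^sub>m n c"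
  shows "B ^\<^sub>m k * V = 0\<^sub>m n c"
proof -
  obtain Y where Y: "Y \<in> carrier_mat n n" "B ^\<^sub>m k = B ^\<^sub>m (k + i) * Y"
    using pow_range_stable[OF B k] by blast
  have e: "B ^\<^sub>m (k + i) = B ^\<^sub>m i * B ^\<^sub>m k" using mat_pow_add[OF B, of i k] by (simp add: add.commute)
  show ?thesis
    by (rule mult_kernel_stable[OF _ _ Y(1) Y(2)[unfolded e] V z[unfolded e]]) (use B in auto)
qed

lemma mat_pow_mult_swap:
  fixes P Q :: "complex mat"
  assumes P: "P \<in> carrier_mat a b" and Q: "Q \<in> carrier_mat b a"
  shows "(P * Q) ^\<^sub>m j * P = P * (Q * P) ^\<^sub>m j"
proof (induction j)
  case (Suc j)
  note d = carrier_matD[OF P] carrier_matD[OF Q]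
  have "(P * Q) ^\<^sub>m Suc j * P = (P * Q) ^\<^sub>m j * P * (Q * P)"
    by (simp add: mult_assoc_dims d)
  also have "\<dots> = P * (Q * P) ^\<^sub>m Suc j" unfolding Suc by (simp add: mult_assoc_dims d)
  finally show ?case .
qed (use P Q in simp)

lemma mat_pow_mult_Suc:
  fixes P Q :: "complex mat"
  assumes P: "P \<in> carrier_mat a b" and Q: "Q \<in> carrier_mat b a"
  shows "(P * Q) ^\<^sub>m Suc j = P * (Q * P) ^\<^sub>m j * Q"
proof -
  note d = carrier_matD[OF P] carrier_matD[OF Q]
  have "(P * Q) ^\<^sub>m Suc j = (P * Q) ^\<^sub>m j * P * Q" by (simp add: mult_assoc_dims d)
  thus ?thesis by (simp only: mat_pow_mult_swap[OF P Q])
qed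

section \<open>The weighted core-EP inverse\<close>

text \<open>With \<open>k\<close> the weighted index, the range of the projector \<open>P\<close> is also that of
  \<open>(Z C)\<^sup>k\<^sup>+\<^sup>2 = Z C Z \<cdot> (C Z)\<^sup>k C\<close>. So \<open>P = Z C Z \<cdot> (C Z)\<^sup>k C Y\<close> for some \<open>Y\<close>, and the
  factor after \<open>Z C Z\<close> is the inverse.\<close>

lemma weighted_core_EP_exists:
  assumes C: "C \<in> carrier_mat a b" and Z: "Z \<in> carrier_mat b a"
  shows "\<exists>X. is_weighted_core_EP Z C X"
proof -
  define k where "k = weighted_index Z C"
  define P where "P = orth_projector b (mat_range ((Z * C) ^\<^sub>m k))"
  have ZC: "Z * C \<in> carrier_mat b b" and CZ: "C * Z \<in> carrier_mat a a" using C Z by auto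
  have ZCk: "(Z * C) ^\<^sub>m k \<in> carrier_mat b b" and CZk: "(C * Z) ^\<^sub>m k \<in> carrier_mat a a"
    using ZC CZ by auto
  have P: "is_orth_projector b (mat_range ((Z * C) ^\<^sub>m k)) P"
    unfolding P_def by (rule orth_projector_correct[OF ZCk])
  hence Pc: "P \<in> carrier_mat b b" "mat_range P = mat_range ((Z * C) ^\<^sub>m k)"
    by (auto simp: is_orth_projector_def)
  obtain Y0 where Y0: "Y0 \<in> carrier_mat b b" "P = (Z * C) ^\<^sub>m k * Y0"
    using mat_range_subset_iff[OF Pc(1) ZCk] Pc(2) by blast
  have "k \<ge> mat_index (Z * C)" by (simp add: k_def weighted_index_def)
  then obtain Y1 where Y1: "Y1 \<in> carrier_mat b b" "(Z * C) ^\<^sub>m k = (Z * C) ^\<^sub>m (k + 2) * Y1"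
    using pow_range_stable[OF ZC] by blast
  note d = carrier_matD[OF C] carrier_matD[OF Z] carrier_matD[OF Y0(1)] carrier_matD[OF Y1(1)]
  \<comment> \<open>Here \<open>Y1 * Y0\<close> is the \<open>Y\<close> with \<open>P = (Z C)\<^sup>k\<^sup>+\<^sup>2 Y\<close>.\<close>
  define X where "X = (C * Z) ^\<^sub>m k * (C * (Y1 * Y0))"
  have Xc: "X \<in> carrier_mat a b" by (auto intro!: carrier_matI simp: X_def d)
  have pw: "(Z * C) ^\<^sub>m (k + 2) = Z * (C * Z * (C * Z) ^\<^sub>m k) * C"
    using mat_pow_mult_Suc[OF Z C, of "Suc k"] mat_pow_add[OF CZ, of 1 k] CZ by simp
  have "Z * C * Z * X = P"
    unfolding Y0(2) Y1(2) pw X_def by (simp add: mult_assoc_dims d)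
  moreover have "mat_range X \<subseteq> mat_range ((C * Z) ^\<^sub>m k)"
    using mat_range_subset_iff[OF Xc CZk] X_def C Y0(1) Y1(1) by (metis mult_carrier_mat)
  ultimately show ?thesis
    unfolding is_weighted_core_EP_def k_def[symmetric] using Xc by (intro exI[of _ X]) (simp add: P_def d carrier_matD[OF Xc])
qed

text \<open>The difference of two solutions has the form \<open>(C Z)\<^sup>k (V - V')\<close> and is annihilated by
  \<open>Z C Z\<close>, hence by \<open>(C Z)\<^sup>2\<close>. But \<open>C Z\<close> is injective on the range of \<open>(C Z)\<^sup>k\<close>.\<close>

lemma weighted_core_EP_unique:
  assumes C: "C \<in> carrier_mat a b" and Z: "Z \<in> carrier_mat b a"
    and X: "is_weighted_core_EP Z C X" and X': "is_weighted_core_EP Z C X'"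
  shows "X = X'"
proof -
  define k where "k = weighted_index Z C"
  have CZ: "C * Z \<in> carrier_mat a a" using C Z by auto
  have CZk: "(C * Z) ^\<^sub>m k \<in> carrier_mat a a" using CZ by auto
  have Xc: "X \<in> carrier_mat a b" "X' \<in> carrier_mat a b" and eq: "Z * C * Z * X = Z * C * Z * X'"
    and ran: "mat_range X \<subseteq> mat_range ((C * Z) ^\<^sub>m k)" "mat_range X' \<subseteq> mat_range ((C * Z) ^\<^sub>m k)"
    using X X' C unfolding is_weighted_core_EP_def k_def by auto
  obtain V where V: "V \<in> carrier_mat a b" "X = (C * Z) ^\<^sub>m k * V"
    using mat_range_subset_iff[OF Xc(1) CZk] ran by blast
  obtain V' where V': "V' \<in> carrier_mat a b" "X' = (C * Z) ^\<^sub>m k * V'"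
    using mat_range_subset_iff[OF Xc(2) CZk] ran by blast
  note d = carrier_matD[OF C] carrier_matD[OF Z] carrier_matD[OF V(1)] carrier_matD[OF V'(1)]
    carrier_matD[OF Xc(1)] carrier_matD[OF Xc(2)]
  have kidx: "k \<ge> mat_index (C * Z)" by (simp add: k_def weighted_index_def)
  have pw: "(C * Z) ^\<^sub>m (k + 2) = C * (Z * C * Z) * (C * Z) ^\<^sub>m k"
    using mat_pow_add[OF CZ, of 2 k] CZ by (simp add: numeral_2_eq_2 mult_assoc_dims d add.commute)
  have e: "(C * Z) ^\<^sub>m (k + 2) * V = (C * Z) ^\<^sub>m (k + 2) * V'"
  proof -
    have "(C * Z) ^\<^sub>m (k + 2) * V = C * (Z * C * Z * X)"
      unfolding pw V(2) by (simp add: mult_assoc_dims d)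
    also have "\<dots> = (C * Z) ^\<^sub>m (k + 2) * V'"
      unfolding eq unfolding pw V'(2) by (simp add: mult_assoc_dims d)
    finally show ?thesis .
  qed
  have CZk2: "(C * Z) ^\<^sub>m (k + 2) \<in> carrier_mat a a" using CZ by (rule pow_carrier_mat)
  have VV: "V - V' \<in> carrier_mat a b" using V V' by auto
  have "(C * Z) ^\<^sub>m (k + 2) * (V - V') = 0\<^sub>m a b"
    unfolding mult_minus_distrib_mat[OF CZk2 V(1) V'(1)] e
    by (rule minus_r_inv_mat[OF mult_carrier_mat[OF CZk2 V'(1)]])
  from pow_kernel_stable[OF CZ kidx VV this]
  have "X - X' = 0\<^sub>m a b" unfolding V(2) V'(2) mult_minus_distrib_mat[OF CZk V(1) V'(1)] .
  show ?thesis
  proof (rule eq_matI)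
    fix i j assume "i < dim_row X'" "j < dim_col X'"
    thus "X $$ (i, j) = X' $$ (i, j)"
      using arg_cong[OF \<open>X - X' = 0\<^sub>m a b\<close>, of "\<lambda>M. M $$ (i, j)"] d by simp
  qed (use d in simp_all)
qed

lemma weighted_core_EP_eqI:
  assumes "C \<in> carrier_mat a b" "Z \<in> carrier_mat b a" "is_weighted_core_EP Z C X"
  shows "weighted_core_EP Z C = X"
  unfolding weighted_core_EP_def using assms weighted_core_EP_unique by blast

lemma weighted_core_EP_correct:
  assumes "C \<in> carrier_mat a b" "Z \<in> carrier_mat b a"
  shows "is_weighted_core_EP Z C (weighted_core_EP Z C)"
  using weighted_core_EP_exists[OF assms] weighted_core_EP_eqI[OF assms] by metis

section \<open>Dilation along isometries\<close>

text \<open>With \<open>A = T F\<close>, \<open>W = S G\<close>, \<open>C = F S\<close> and \<open>Z = G T\<close>, the alternating products collapse: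
  \<open>(W A)\<^sup>j\<^sup>+\<^sup>1 = S (Z C)\<^sup>j Z F\<close> and \<open>(A W)\<^sup>j\<^sup>+\<^sup>1 = T (C Z)\<^sup>j C G\<close>. Since \<open>Z C = Z F S\<close>, the
  range of \<open>(Z C)\<^sup>j Z F\<close> lies between those of \<open>(Z C)\<^sup>j\<^sup>+\<^sup>1\<close> and \<open>(Z C)\<^sup>j\<close>. For large \<open>j\<close> both
  are the range of \<open>P\<close>, the projector for the pair \<open>C\<close>, \<open>Z\<close>; so the range of \<open>(W A)\<^sup>j\<^sup>+\<^sup>1\<close> is
  that of \<open>S P S\<^sup>*\<close>, which is an orthogonal projector because \<open>S\<close> is an isometry. The product
  \<open>W A W \<cdot> T X S\<^sup>*\<close> collapses to \<open>S P S\<^sup>*\<close> as well. The weighted indices of the two pairs may differ,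
  so ranges are compared at the common exponent \<open>N + 1\<close> that exceeds both.\<close>

lemma weighted_core_EP_dilation:
  assumes T: "T \<in> carrier_mat q a" and S: "S \<in> carrier_mat n b"
    and F: "F \<in> carrier_mat a n" and G: "G \<in> carrier_mat b q"
    and TT: "mat_adjoint T * T = 1\<^sub>m a" and SS: "mat_adjoint S * S = 1\<^sub>m b"
    and X: "is_weighted_core_EP (G * T) (F * S) X"
  shows "is_weighted_core_EP (S * G) (T * F) (T * X * mat_adjoint S)"
proof -
  define C Z A W where defs: "C = F * S" "Z = G * T" "A = T * F" "W = S * G"
  define k l N where "k = weighted_index Z C" and "l = weighted_index W A" and "N = max k l"
  define P where "P = orth_projector b (mat_range ((Z * C) ^\<^sub>m k))"
  note d0 = carrier_matD[OF T] carrier_matD[OF S] carrier_matD[OF F] carrier_matD[OF G]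
  have C: "C \<in> carrier_mat a b" and Z: "Z \<in> carrier_mat b a"
    and A: "A \<in> carrier_mat q n" and W: "W \<in> carrier_mat n q"
    by (auto intro!: carrier_matI simp: defs d0)
  have ZC: "Z * C \<in> carrier_mat b b" and CZ: "C * Z \<in> carrier_mat a a"
    and WA: "W * A \<in> carrier_mat n n" and AW: "A * W \<in> carrier_mat q q" using C Z A W by auto
  have ZCp: "(Z * C) ^\<^sub>m j \<in> carrier_mat b b" and CZp: "(C * Z) ^\<^sub>m j \<in> carrier_mat a a"
    and WAp: "(W * A) ^\<^sub>m j \<in> carrier_mat n n" and AWp: "(A * W) ^\<^sub>m j \<in> carrier_mat q q" for j
    using ZC CZ WA AW by auto
  have Xc: "X \<in> carrier_mat a b" and Xeq: "Z * C * Z * X = P"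
    and Xran: "mat_range X \<subseteq> mat_range ((C * Z) ^\<^sub>m k)"
    using X C unfolding is_weighted_core_EP_def P_def k_def defs(1,2)[symmetric] by auto
  have P: "is_orth_projector b (mat_range ((Z * C) ^\<^sub>m k)) P"
    unfolding P_def by (rule orth_projector_correct[OF ZCp])
  hence Pc: "P \<in> carrier_mat b b" and PP: "P * P = P" and Padj: "mat_adjoint P = P"
    and Pran: "mat_range P = mat_range ((Z * C) ^\<^sub>m k)"
    by (auto simp: is_orth_projector_def)
  note d = d0 carrier_matD[OF C] carrier_matD[OF Z] carrier_matD[OF A] carrier_matD[OF W]
    carrier_matD[OF Xc] carrier_matD[OF Pc]
  have SS': "mat_adjoint S * (S * M) = M" if "dim_row M = b" for M
    using that SS by (simp flip: mult_assoc_dims add: d0)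
  have TT': "G * (T * M) = Z * M" if "dim_row M = a" for M
    using that by (simp add: mult_assoc_dims defs d0)
  have FS': "F * (S * M) = C * M" if "dim_row M = b" for M
    using that by (simp add: mult_assoc_dims defs d0)
  have WA_pow: "(W * A) ^\<^sub>m Suc j = S * ((Z * C) ^\<^sub>m j * (Z * F))" for j
  proof -
    have ZF: "Z * F \<in> carrier_mat b n" using Z F by simp
    have "W * A = S * (Z * F)" by (simp add: defs mult_assoc_dims d0)
    moreover have "Z * F * S = Z * C" by (simp add: defs mult_assoc_dims d0)
    ultimately show ?thesis
      using mat_pow_mult_Suc[OF S ZF, of j] by (simp add: mult_assoc_dims d del: pow_mat.simps)
  qed
  have AW_pow: "(A * W) ^\<^sub>m Suc j = T * ((C * Z) ^\<^sub>m j * (C * G))" for j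
  proof -
    have CG: "C * G \<in> carrier_mat a q" using C G by simp
    have "A * W = T * (C * G)" by (simp add: defs mult_assoc_dims d0)
    moreover have "C * G * T = C * Z" by (simp add: defs mult_assoc_dims d0)
    ultimately show ?thesis
      using mat_pow_mult_Suc[OF T CG, of j] by (simp add: mult_assoc_dims d del: pow_mat.simps)
  qed
  let ?Q = "S * P * mat_adjoint S"
  have Qc: "?Q \<in> carrier_mat n n" by (auto intro!: carrier_matI simp: d)
  have kidx: "k \<ge> mat_index (Z * C)" "k \<ge> mat_index (C * Z)"
    and lidx: "l \<ge> mat_index (W * A)"
    by (auto simp: k_def l_def weighted_index_def)
  have ran_WA: "mat_range ((W * A) ^\<^sub>m l) = mat_range ?Q"
  proof
    obtain Y where Y: "Y \<in> carrier_mat n n" "(W * A) ^\<^sub>m l = (W * A) ^\<^sub>m (l + (Suc N - l)) * Y"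
      using pow_range_stable[OF WA lidx] by blast
    have lN: "l + (Suc N - l) = Suc N" by (simp add: N_def)
    have "P * (Z * C) ^\<^sub>m k = (Z * C) ^\<^sub>m k" by (rule orth_projector_absorb[OF P ZCp]) simp
    hence PN: "P * (Z * C) ^\<^sub>m N = (Z * C) ^\<^sub>m N"
      using mat_pow_add[OF ZC, of k "N - k"] d
      by (simp add: N_def mult_assoc_dims[symmetric])
    have "(W * A) ^\<^sub>m l = ?Q * ((W * A) ^\<^sub>m Suc N * Y)"
    proof -
      have "?Q * ((W * A) ^\<^sub>m Suc N * Y) = S * ((P * (Z * C) ^\<^sub>m N) * (Z * F) * Y)"
        unfolding WA_pow using carrier_matD[OF Y(1)] by (simp add: mult_assoc_dims d SS')
      also have "\<dots> = (W * A) ^\<^sub>m Suc N * Y"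
        unfolding WA_pow PN using carrier_matD[OF Y(1)] by (simp add: mult_assoc_dims d)
      finally show ?thesis using Y(2) unfolding lN by argo
    qed
    moreover have "(W * A) ^\<^sub>m Suc N * Y \<in> carrier_mat n n" using WAp Y(1) by (metis mult_carrier_mat)
    ultimately show "mat_range ((W * A) ^\<^sub>m l) \<subseteq> mat_range ?Q"
      using mat_range_subset_iff[OF WAp Qc] by blast
  next
    obtain Y0 where Y0: "Y0 \<in> carrier_mat b b" "P = (Z * C) ^\<^sub>m k * Y0"
      using mat_range_subset_iff[OF Pc ZCp] Pran by blast
    obtain Y where Y: "Y \<in> carrier_mat b b" "(Z * C) ^\<^sub>m k = (Z * C) ^\<^sub>m (k + (Suc N - k)) * Y"
      using pow_range_stable[OF ZC kidx(1)] by blast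
    have kN: "k + (Suc N - k) = Suc N" by (simp add: N_def)
    note d' = d carrier_matD[OF Y0(1)] carrier_matD[OF Y(1)]
    define V where "V = S * (Y * (Y0 * mat_adjoint S))"
    have V: "V \<in> carrier_mat n n" by (auto intro!: carrier_matI simp: V_def d')
    have "?Q = S * ((Z * C) ^\<^sub>m Suc N * Y * Y0) * mat_adjoint S" using Y0(2) Y(2) kN by argo
    also have "\<dots> = (W * A) ^\<^sub>m Suc N * V"
      unfolding WA_pow V_def by (simp add: mult_assoc_dims d' FS')
    also have "\<dots> = (W * A) ^\<^sub>m l * ((W * A) ^\<^sub>m (Suc N - l) * V)"
    proof -
      have e: "(W * A) ^\<^sub>m Suc N = (W * A) ^\<^sub>m l * (W * A) ^\<^sub>m (Suc N - l)"
        using mat_pow_add[OF WA, of l "Suc N - l"] by (simp add: N_def del: pow_mat.simps)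
      show ?thesis unfolding e using assoc_mult_mat[OF WAp WAp V] .
    qed
    finally show "mat_range ?Q \<subseteq> mat_range ((W * A) ^\<^sub>m l)"
      using mat_range_subset_iff[OF Qc WAp] V WAp by (metis mult_carrier_mat)
  qed
  have "is_orth_projector n (mat_range ((W * A) ^\<^sub>m l)) ?Q"
    unfolding is_orth_projector_def ran_WA
  proof (intro conjI Qc refl)
    have "?Q * ?Q = S * (P * P) * mat_adjoint S" by (simp add: mult_assoc_dims d SS')
    thus "?Q * ?Q = ?Q" unfolding PP .
    show "mat_adjoint ?Q = ?Q" by (simp add: mat_adjoint_mult mult_assoc_dims d Padj)
  qed
  hence proj: "orth_projector n (mat_range ((W * A) ^\<^sub>m l)) = ?Q" by (rule orth_projector_eqI)
  let ?X = "T * X * mat_adjoint S"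
  have X'c: "?X \<in> carrier_mat q n" by (auto intro!: carrier_matI simp: d)
  have "W * A * W * ?X = S * (Z * C * Z * X) * mat_adjoint S"
    unfolding defs(3,4) by (simp add: mult_assoc_dims d TT' FS')
  hence eq: "W * A * W * ?X = ?Q" unfolding Xeq .
  have "mat_range ?X \<subseteq> mat_range ((A * W) ^\<^sub>m l)"
  proof -
    obtain Y0 where Y0: "Y0 \<in> carrier_mat a b" "X = (C * Z) ^\<^sub>m k * Y0"
      using mat_range_subset_iff[OF Xc CZp] Xran by blast
    obtain Y where Y: "Y \<in> carrier_mat a a" "(C * Z) ^\<^sub>m k = (C * Z) ^\<^sub>m (k + (Suc N - k)) * Y"
      using pow_range_stable[OF CZ kidx(2)] by blast
    have kN: "k + (Suc N - k) = Suc N" by (simp add: N_def)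
    note d' = d carrier_matD[OF Y0(1)] carrier_matD[OF Y(1)]
    define V where "V = T * (Y * (Y0 * mat_adjoint S))"
    have V: "V \<in> carrier_mat q n" by (auto intro!: carrier_matI simp: V_def d')
    have "?X = T * ((C * Z) ^\<^sub>m Suc N * Y * Y0) * mat_adjoint S" using Y0(2) Y(2) kN by argo
    also have "\<dots> = (A * W) ^\<^sub>m Suc N * V"
      unfolding AW_pow V_def by (simp add: mult_assoc_dims d' TT')
    also have "\<dots> = (A * W) ^\<^sub>m l * ((A * W) ^\<^sub>m (Suc N - l) * V)"
    proof -
      have e: "(A * W) ^\<^sub>m Suc N = (A * W) ^\<^sub>m l * (A * W) ^\<^sub>m (Suc N - l)"
        using mat_pow_add[OF AW, of l "Suc N - l"] by (simp add: N_def del: pow_mat.simps)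
      show ?thesis unfolding e using assoc_mult_mat[OF AWp AWp V] .
    qed
    finally show ?thesis
      using mat_range_subset_iff[OF X'c AWp] V AWp by (metis mult_carrier_mat)
  qed
  with X'c eq proj show ?thesis
    unfolding is_weighted_core_EP_def defs(3,4)[symmetric] l_def[symmetric] using A by auto
qed

lemma weighted_pow_Suc:
  assumes X: "X \<in> carrier_mat a b" and Z: "Z \<in> carrier_mat b a"
  shows "weighted_pow Z X (Suc l) = X * (Z * X) ^\<^sub>m l"
proof (induction l)
  case (Suc l)
  thus ?case
    by (simp add: weighted_prod_def mult_assoc_dims carrier_matD[OF X] carrier_matD[OF Z])
qed (use X Z in simp)

text \<open>Covers both kinds of weighted powers in the weak group inverse: those of \<open>A\<close> and those of its
  core-EP inverse are both of the form \<open>T Y\<close>, and between two factors only \<open>Y W T\<close> remains.\<close>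

lemma weighted_pow_dilation:
  assumes T: "T \<in> carrier_mat q a" and Y: "Y \<in> carrier_mat a n" and W: "W \<in> carrier_mat n q"
    and M: "M \<in> carrier_mat a a" and YWT: "Y * W * T = M"
  shows "weighted_pow W (T * Y) (Suc l) = T * (M ^\<^sub>m l * Y)"
proof (induction l)
  case 0
  show ?case using Y M by simp
next
  case (Suc l)
  note d = carrier_matD[OF T] carrier_matD[OF Y] carrier_matD[OF W] carrier_matD[OF M]
  have "weighted_pow W (T * Y) (Suc (Suc l)) = T * (M ^\<^sub>m l * Y) * W * (T * Y)"
    by (simp only: weighted_pow.simps weighted_prod_def Suc)
  also have "\<dots> = T * (M ^\<^sub>m l * (Y * W * T) * Y)" by (simp add: mult_assoc_dims d)
  also have "\<dots> = T * (M ^\<^sub>m Suc l * Y)" unfolding YWT by simp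
  finally show ?case .
qed

text \<open>The core-EP inverse of the large pair is \<open>T X S\<^sup>*\<close>. In the product defining the weak group
  inverse all inner factors \<open>T\<close>, \<open>S\<close> are absorbed into \<open>C\<close> and \<open>Z\<close>; only the outermost
  factors \<open>T\<close> and \<open>F\<close> remain.\<close>

lemma weighted_weak_group_dilation:
  assumes T: "T \<in> carrier_mat q a" and S: "S \<in> carrier_mat n b"
    and F: "F \<in> carrier_mat a n" and G: "G \<in> carrier_mat b q"
    and TT: "mat_adjoint T * T = 1\<^sub>m a" and SS: "mat_adjoint S * S = 1\<^sub>m b"
    and m: "m > 0"
  defines "C \<equiv> F * S" and "Z \<equiv> G * T"
  defines "X \<equiv> weighted_core_EP Z C"
  shows "weighted_weak_group m (S * G) (T * F)
    = T * (weighted_pow Z X (m + 1) * Z * (C * Z) ^\<^sub>m (m - 1) * F)"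
proof -
  have C: "C \<in> carrier_mat a b" and Z: "Z \<in> carrier_mat b a"
    using T S F G by (auto simp: C_def Z_def)
  have X: "is_weighted_core_EP Z C X" unfolding X_def by (rule weighted_core_EP_correct[OF C Z])
  hence Xc: "X \<in> carrier_mat a b" using C by (simp add: is_weighted_core_EP_def)
  note d = carrier_matD[OF T] carrier_matD[OF S] carrier_matD[OF F] carrier_matD[OF G]
    carrier_matD[OF C] carrier_matD[OF Z] carrier_matD[OF Xc]
  have TF: "T * F \<in> carrier_mat q n" and SG: "S * G \<in> carrier_mat n q"
    using T S F G by auto
  have "is_weighted_core_EP (S * G) (T * F) (T * X * mat_adjoint S)"
    using weighted_core_EP_dilation[OF T S F G TT SS] X by (simp add: C_def Z_def)
  hence "weighted_core_EP (S * G) (T * F) = T * X * mat_adjoint S"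
    by (rule weighted_core_EP_eqI[OF TF SG])
  hence core: "weighted_core_EP (S * G) (T * F) = T * (X * mat_adjoint S)"
    by (simp add: mult_assoc_dims d)
  have SS': "mat_adjoint S * (S * M) = M" if "dim_row M = b" for M
    using that SS by (simp flip: mult_assoc_dims add: d)
  obtain p where p: "m = Suc p" using m by (cases m) auto
  have XZ: "X * Z \<in> carrier_mat a a" and CZ: "C * Z \<in> carrier_mat a a" using Xc C Z by auto
  have XS: "X * mat_adjoint S \<in> carrier_mat a n" by (auto intro!: carrier_matI simp: d)
  have "X * mat_adjoint S * (S * G) * T = X * Z" by (simp add: mult_assoc_dims d SS' Z_def)
  from weighted_pow_dilation[OF T XS SG XZ this, of m]
  have 1: "weighted_pow (S * G) (T * (X * mat_adjoint S)) (m + 1)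
      = T * ((X * Z) ^\<^sub>m m * (X * mat_adjoint S))" by simp
  have "F * (S * G) * T = C * Z" by (simp add: mult_assoc_dims d C_def Z_def)
  from weighted_pow_dilation[OF T F SG CZ this, of p]
  have 2: "weighted_pow (S * G) (T * F) m = T * ((C * Z) ^\<^sub>m p * F)" by (simp add: p)
  have 3: "weighted_pow Z X (m + 1) = (X * Z) ^\<^sub>m m * X"
    using weighted_pow_Suc[OF Xc Z, of m] mat_pow_mult_swap[OF Xc Z, of m] by simp
  have GT: "G * (T * M) = Z * M" if "dim_row M = a" for M
    using that by (simp add: Z_def mult_assoc_dims d)
  show ?thesis
    unfolding weighted_weak_group_def core 1 2 3
    by (simp add: mult_assoc_dims d SS' GT p del: pow_mat.simps)
qed

section \<open>Unitary matrices in block form\<close>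

definition left_cols :: "nat \<Rightarrow> complex mat \<Rightarrow> complex mat" where
  "left_cols r M = mat (dim_row M) r (\<lambda>(i, j). M $$ (i, j))"

definition right_cols :: "nat \<Rightarrow> complex mat \<Rightarrow> complex mat" where
  "right_cols r M = mat (dim_row M) (dim_col M - r) (\<lambda>(i, j). M $$ (i, r + j))"

lemma left_right_cols_carrier [simp]:
  assumes "M \<in> carrier_mat n m"
  shows "left_cols r M \<in> carrier_mat n r" "right_cols r M \<in> carrier_mat n (m - r)"
  using assms by (auto simp: left_cols_def right_cols_def)

lemma adjoint_blocks:
  assumes U: "U \<in> carrier_mat n n" and S: "S \<in> carrier_mat n n" and r: "r \<le> n" "s \<le> n"
    and K: "K \<in> carrier_mat r s" and L: "L \<in> carrier_mat r (n - s)"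
    and H: "H \<in> carrier_mat (n - r) s" and R: "R \<in> carrier_mat (n - r) (n - s)"
    and eq: "mat_adjoint U * S = four_block_mat K L H R"
  shows "mat_adjoint (left_cols r U) * left_cols s S = K"
    and "mat_adjoint (left_cols r U) * right_cols s S = L"
proof -
  have entry: "(\<Sum>l<n. cnj (U $$ (l, i)) * S $$ (l, j)) = four_block_mat K L H R $$ (i, j)"
    if "i < n" "j < n" for i j
    using arg_cong[OF eq, of "\<lambda>M. M $$ (i, j)"] that U S
    by (simp add: scalar_prod_def atLeast0LessThan)
  show "mat_adjoint (left_cols r U) * left_cols s S = K"
  proof (rule eq_matI)
    fix i j assume ij: "i < dim_row K" "j < dim_col K"
    thus "(mat_adjoint (left_cols r U) * left_cols s S) $$ (i, j) = K $$ (i, j)"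
      using U S K R r entry[of i j]
      by (simp add: scalar_prod_def atLeast0LessThan left_cols_def)
  qed (use U S K in \<open>auto simp: left_cols_def\<close>)
  show "mat_adjoint (left_cols r U) * right_cols s S = L"
  proof (rule eq_matI)
    fix i j assume ij: "i < dim_row L" "j < dim_col L"
    thus "(mat_adjoint (left_cols r U) * right_cols s S) $$ (i, j) = L $$ (i, j)"
      using U S K L R r entry[of i "s + j"]
      by (simp add: scalar_prod_def atLeast0LessThan left_cols_def right_cols_def)
  qed (use U S L in \<open>auto simp: left_cols_def right_cols_def\<close>)
qed

lemma left_cols_isometry:
  assumes U: "unitary_mat n U" and r: "r \<le> n"
  shows "mat_adjoint (left_cols r U) * left_cols r U = 1\<^sub>m r"
    and "mat_adjoint (left_cols r U) * right_cols r U = 0\<^sub>m r (n - r)"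
proof -
  have Uc: "U \<in> carrier_mat n n" using U by (simp add: unitary_mat_def)
  have "mat_adjoint U * U
      = four_block_mat (1\<^sub>m r) (0\<^sub>m r (n - r)) (0\<^sub>m (n - r) r) (1\<^sub>m (n - r))"
    using U r by (simp add: unitary_mat_def)
  note * = adjoint_blocks[OF Uc Uc r r _ _ _ _ this]
  show "mat_adjoint (left_cols r U) * left_cols r U = 1\<^sub>m r"
    and "mat_adjoint (left_cols r U) * right_cols r U = 0\<^sub>m r (n - r)"
    by (rule *; simp)+
qed

text \<open>Passage between the thin product and the block form: since \<open>S S\<^sup>* = 1\<close>, one has
  \<open>Y = (Y S) S\<^sup>*\<close>, and the leading columns of \<open>T\<close> multiply \<open>Y S\<close> like \<open>T\<close> multiplies \<open>Y S\<close> padded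
  with zero rows.\<close>

lemma left_cols_mult_eq_block:
  assumes T: "T \<in> carrier_mat q q" and S: "unitary_mat n S" and r: "r \<le> q" and s: "s \<le> n"
    and Y: "Y \<in> carrier_mat r n"
  shows "left_cols r T * Y =
    T * four_block_mat (Y * left_cols s S) (Y * right_cols s S)
          (0\<^sub>m (q - r) s) (0\<^sub>m (q - r) (n - s)) * mat_adjoint S"
proof -
  have Sc: "S \<in> carrier_mat n n" and SS: "S * mat_adjoint S = 1\<^sub>m n"
    using S by (auto simp: unitary_mat_def)
  let ?B = "four_block_mat (Y * left_cols s S) (Y * right_cols s S)
          (0\<^sub>m (q - r) s) (0\<^sub>m (q - r) (n - s))"
  have dB: "dim_row ?B = q" "dim_col ?B = n" using Y r s Sc by (auto simp: left_cols_def right_cols_def)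
  have B: "?B $$ (k, j) = (if k < r then (Y * S) $$ (k, j) else 0)" if "k < q" "j < n" for k j
    using that Y Sc r s
    by (auto simp: left_cols_def right_cols_def scalar_prod_def intro!: sum.cong)
  have "T * ?B = left_cols r T * (Y * S)"
  proof (rule eq_matI)
    fix i j assume "i < dim_row (left_cols r T * (Y * S))" "j < dim_col (left_cols r T * (Y * S))"
    hence ij: "i < q" "j < n" using T Sc by (auto simp: left_cols_def)
    have "(T * ?B) $$ (i, j) = (\<Sum>k<q. T $$ (i, k) * ?B $$ (k, j))"
      using ij T dB by (simp add: scalar_prod_def atLeast0LessThan del: index_mat_four_block)
    also have "\<dots> = (\<Sum>k<q. if k < r then T $$ (i, k) * (Y * S) $$ (k, j) else 0)"
      using ij by (intro sum.cong) (auto simp: B simp del: index_mat_four_block index_mult_mat)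
    also have "\<dots> = (\<Sum>k<r. T $$ (i, k) * (Y * S) $$ (k, j))"
      using r by (intro sum.mono_neutral_cong_right) auto
    also have "\<dots> = (left_cols r T * (Y * S)) $$ (i, j)"
      using ij T Y Sc by (simp add: scalar_prod_def atLeast0LessThan left_cols_def)
    finally show "(T * ?B) $$ (i, j) = (left_cols r T * (Y * S)) $$ (i, j)" .
  qed (use T Sc dB in \<open>auto simp: left_cols_def\<close>)
  hence "T * ?B * mat_adjoint S = left_cols r T * (Y * (S * mat_adjoint S))"
    using T Y Sc by (simp add: mult_assoc_dims left_cols_def)
  thus ?thesis using SS Y by simp
qed

section \<open>The block form of the weighted weak group inverse\<close>

theorem theorem3p8:
  fixes q n r\<^sub>1 r\<^sub>2 m :: nat
    and A W T U S V \<Sigma>\<^sub>1 \<Sigma>\<^sub>2 K\<^sub>1 L\<^sub>1 H\<^sub>1 R\<^sub>1 K\<^sub>2 L\<^sub>2 H\<^sub>2 R\<^sub>2 :: "complex mat"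
  assumes "A \<in> carrier_mat q n" and "mat_rank A = r\<^sub>1"
    and "W \<in> carrier_mat n q" and "W \<noteq> 0\<^sub>m n q" and "mat_rank W = r\<^sub>2"
    and "is_svd q n r\<^sub>1 A T \<Sigma>\<^sub>1 U"
    and "is_svd n q r\<^sub>2 W S \<Sigma>\<^sub>2 V"
    and "invertible_mat \<Sigma>\<^sub>1" and "invertible_mat \<Sigma>\<^sub>2"
    and "K\<^sub>1 \<in> carrier_mat r\<^sub>1 r\<^sub>2" and "L\<^sub>1 \<in> carrier_mat r\<^sub>1 (n - r\<^sub>2)"
    and "H\<^sub>1 \<in> carrier_mat (n - r\<^sub>1) r\<^sub>2" and "R\<^sub>1 \<in> carrier_mat (n - r\<^sub>1) (n - r\<^sub>2)"
    and "mat_adjoint U * S = four_block_mat K\<^sub>1 L\<^sub>1 H\<^sub>1 R\<^sub>1"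
    and "K\<^sub>2 \<in> carrier_mat r\<^sub>2 r\<^sub>1" and "L\<^sub>2 \<in> carrier_mat r\<^sub>2 (q - r\<^sub>1)"
    and "H\<^sub>2 \<in> carrier_mat (q - r\<^sub>2) r\<^sub>1" and "R\<^sub>2 \<in> carrier_mat (q - r\<^sub>2) (q - r\<^sub>1)"
    and "mat_adjoint V * T = four_block_mat K\<^sub>2 L\<^sub>2 H\<^sub>2 R\<^sub>2"
    and "m > 0"
  shows "A = T * four_block_mat (\<Sigma>\<^sub>1 * K\<^sub>1) (\<Sigma>\<^sub>1 * L\<^sub>1)
                   (0\<^sub>m (q - r\<^sub>1) r\<^sub>2) (0\<^sub>m (q - r\<^sub>1) (n - r\<^sub>2)) * mat_adjoint S \<and>
    W = S * four_block_mat (\<Sigma>\<^sub>2 * K\<^sub>2) (\<Sigma>\<^sub>2 * L\<^sub>2)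
              (0\<^sub>m (n - r\<^sub>2) r\<^sub>1) (0\<^sub>m (n - r\<^sub>2) (q - r\<^sub>1)) * mat_adjoint T \<and>
    (let Z = \<Sigma>\<^sub>2 * K\<^sub>2;
         C = \<Sigma>\<^sub>1 * K\<^sub>1;
         X = weighted_core_EP Z C;
         B = X * (Z * X) ^\<^sub>m m * (Z * C) ^\<^sub>m (m - 1) * (Z * (\<Sigma>\<^sub>1 * L\<^sub>1))
     in weighted_weak_group m W A =
          T * four_block_mat (weighted_weak_group m Z C) B
                (0\<^sub>m (q - r\<^sub>1) r\<^sub>2) (0\<^sub>m (q - r\<^sub>1) (n - r\<^sub>2)) * mat_adjoint S)"
proof -
  have uT: "unitary_mat q T" and uU: "unitary_mat n U" and uS: "unitary_mat n S"
    and uV: "unitary_mat q V" and \<Sigma>: "\<Sigma>\<^sub>1 \<in> carrier_mat r\<^sub>1 r\<^sub>1" "\<Sigma>\<^sub>2 \<in> carrier_mat r\<^sub>2 r\<^sub>2"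
    and A: "A = T * four_block_mat \<Sigma>\<^sub>1 (0\<^sub>m r\<^sub>1 (n - r\<^sub>1)) (0\<^sub>m (q - r\<^sub>1) r\<^sub>1)
                (0\<^sub>m (q - r\<^sub>1) (n - r\<^sub>1)) * mat_adjoint U"
    and W: "W = S * four_block_mat \<Sigma>\<^sub>2 (0\<^sub>m r\<^sub>2 (q - r\<^sub>2)) (0\<^sub>m (n - r\<^sub>2) r\<^sub>2)
                (0\<^sub>m (n - r\<^sub>2) (q - r\<^sub>2)) * mat_adjoint V"
    using assms(6,7) by (auto simp: is_svd_def singular_value_block_def)
  have Tc: "T \<in> carrier_mat q q" and Uc: "U \<in> carrier_mat n n" and Sc: "S \<in> carrier_mat n n"
    and Vc: "V \<in> carrier_mat q q" using uT uU uS uV by (auto simp: unitary_mat_def)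
  have r1: "r\<^sub>1 \<le> q" "r\<^sub>1 \<le> n" using mat_rank_le[OF assms(1)] assms(2) by auto
  have r2: "r\<^sub>2 \<le> n" "r\<^sub>2 \<le> q" using mat_rank_le[OF assms(3)] assms(5) by auto
  define T1 S1 S2 T2 where "T1 = left_cols r\<^sub>1 T" and "S1 = left_cols r\<^sub>2 S"
    and "S2 = right_cols r\<^sub>2 S" and "T2 = right_cols r\<^sub>1 T"
  define U1 V1 where "U1 = left_cols r\<^sub>1 U" and "V1 = left_cols r\<^sub>2 V"
  \<comment> \<open>\<open>A = T1 F\<close> and \<open>W = S1 G\<close> are the compact forms of the singular value decompositions.\<close>
  define F G where "F = \<Sigma>\<^sub>1 * mat_adjoint U1" and "G = \<Sigma>\<^sub>2 * mat_adjoint V1"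
  have c: "T1 \<in> carrier_mat q r\<^sub>1" "T2 \<in> carrier_mat q (q - r\<^sub>1)" "S1 \<in> carrier_mat n r\<^sub>2"
    "S2 \<in> carrier_mat n (n - r\<^sub>2)" "U1 \<in> carrier_mat n r\<^sub>1" "V1 \<in> carrier_mat q r\<^sub>2"
    using Tc Sc Uc Vc by (auto simp: T1_def T2_def S1_def S2_def U1_def V1_def)
  note d = c[THEN carrier_matD(1)] c[THEN carrier_matD(2)] \<Sigma>[THEN carrier_matD(1)]
    \<Sigma>[THEN carrier_matD(2)]
  have F: "F \<in> carrier_mat r\<^sub>1 n" and G: "G \<in> carrier_mat r\<^sub>2 q"
    by (auto intro!: carrier_matI simp: F_def G_def d)
  have TT: "mat_adjoint T1 * T1 = 1\<^sub>m r\<^sub>1" and SS: "mat_adjoint S1 * S1 = 1\<^sub>m r\<^sub>2"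
    unfolding T1_def S1_def using left_cols_isometry uT uS r1 r2 by auto
  have US: "mat_adjoint U1 * S1 = K\<^sub>1" "mat_adjoint U1 * S2 = L\<^sub>1"
    unfolding U1_def S1_def S2_def
    using adjoint_blocks[OF Uc Sc r1(2) r2(1) assms(10-14)] by auto
  have VT: "mat_adjoint V1 * T1 = K\<^sub>2" "mat_adjoint V1 * T2 = L\<^sub>2"
    unfolding V1_def T1_def T2_def
    using adjoint_blocks[OF Vc Tc r2(2) r1(1) assms(15-19)] by auto
  have FS: "F * S1 = \<Sigma>\<^sub>1 * K\<^sub>1" "F * S2 = \<Sigma>\<^sub>1 * L\<^sub>1"
    unfolding F_def by (simp_all add: mult_assoc_dims d US)
  have GT: "G * T1 = \<Sigma>\<^sub>2 * K\<^sub>2" "G * T2 = \<Sigma>\<^sub>2 * L\<^sub>2"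
    unfolding G_def by (simp_all add: mult_assoc_dims d VT)
  have block_T: "T1 * Y = T * four_block_mat (Y * S1) (Y * S2)
      (0\<^sub>m (q - r\<^sub>1) r\<^sub>2) (0\<^sub>m (q - r\<^sub>1) (n - r\<^sub>2)) * mat_adjoint S"
    if "Y \<in> carrier_mat r\<^sub>1 n" for Y
    unfolding T1_def S1_def S2_def by (rule left_cols_mult_eq_block[OF Tc uS r1(1) r2(1) that])
  have AF: "A = T1 * F"
  proof -
    have "F * left_cols r\<^sub>1 U = \<Sigma>\<^sub>1" "F * right_cols r\<^sub>1 U = 0\<^sub>m r\<^sub>1 (n - r\<^sub>1)"
      unfolding F_def using left_cols_isometry[OF uU r1(2)] \<Sigma>(1) Uc
      by (simp_all add: U1_def mult_assoc_dims left_cols_def right_cols_def)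
    thus ?thesis
      unfolding T1_def A using left_cols_mult_eq_block[OF Tc uU r1(1) r1(2) F] by simp
  qed
  have WG: "W = S1 * G"
  proof -
    have "G * left_cols r\<^sub>2 V = \<Sigma>\<^sub>2" "G * right_cols r\<^sub>2 V = 0\<^sub>m r\<^sub>2 (q - r\<^sub>2)"
      unfolding G_def using left_cols_isometry[OF uV r2(2)] \<Sigma>(2) Vc
      by (simp_all add: V1_def mult_assoc_dims left_cols_def right_cols_def)
    thus ?thesis
      unfolding S1_def W using left_cols_mult_eq_block[OF Sc uV r2(1) r2(2) G] by simp
  qed
  have 1: "A = T * four_block_mat (\<Sigma>\<^sub>1 * K\<^sub>1) (\<Sigma>\<^sub>1 * L\<^sub>1)
      (0\<^sub>m (q - r\<^sub>1) r\<^sub>2) (0\<^sub>m (q - r\<^sub>1) (n - r\<^sub>2)) * mat_adjoint S"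
    unfolding AF block_T[OF F] FS ..
  have 2: "W = S * four_block_mat (\<Sigma>\<^sub>2 * K\<^sub>2) (\<Sigma>\<^sub>2 * L\<^sub>2)
      (0\<^sub>m (n - r\<^sub>2) r\<^sub>1) (0\<^sub>m (n - r\<^sub>2) (q - r\<^sub>1)) * mat_adjoint T"
    unfolding WG GT[symmetric] S1_def T1_def T2_def
    by (rule left_cols_mult_eq_block[OF Sc uT r2(1) r1(1) G])
  define C Z where "C = \<Sigma>\<^sub>1 * K\<^sub>1" and "Z = \<Sigma>\<^sub>2 * K\<^sub>2"
  define X where "X = weighted_core_EP Z C"
  have C: "C \<in> carrier_mat r\<^sub>1 r\<^sub>2" and Z: "Z \<in> carrier_mat r\<^sub>2 r\<^sub>1"
    using \<Sigma> assms(10,15) by (auto simp: C_def Z_def)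
  have Xc: "X \<in> carrier_mat r\<^sub>1 r\<^sub>2"
    using weighted_core_EP_correct[OF C Z] C by (simp add: X_def is_weighted_core_EP_def)
  note d' = d carrier_matD[OF C] carrier_matD[OF Z] carrier_matD[OF Xc] carrier_matD[OF F]
    carrier_matD[OF G] carrier_matD[OF assms(11)]
  obtain p where p: "m = Suc p" using assms(20) by (cases m) auto
  \<comment> \<open>The result is \<open>T1 N F\<close>; its two blocks are \<open>N F S1 = N \<Sigma>\<^sub>1 K\<^sub>1\<close> and \<open>N F S2 = N \<Sigma>\<^sub>1 L\<^sub>1\<close>.\<close>
  define N where "N = weighted_pow Z X (m + 1) * Z * (C * Z) ^\<^sub>m (m - 1)"
  have pow: "weighted_pow Z X (m + 1) = X * (Z * X) ^\<^sub>m m"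
    using weighted_pow_Suc[OF Xc Z, of m] by simp
  have N: "N \<in> carrier_mat r\<^sub>1 r\<^sub>1"
    unfolding N_def pow by (intro carrier_matI) (simp_all add: d')
  have NF: "N * F \<in> carrier_mat r\<^sub>1 n" using N F by simp
  have "weighted_weak_group m W A = T1 * (N * F)"
    unfolding AF WG N_def X_def C_def Z_def
    using weighted_weak_group_dilation[OF c(1,3) F G TT SS assms(20)] by (simp add: FS GT)
  also have "\<dots> = T * four_block_mat (N * F * S1) (N * F * S2)
      (0\<^sub>m (q - r\<^sub>1) r\<^sub>2) (0\<^sub>m (q - r\<^sub>1) (n - r\<^sub>2)) * mat_adjoint S"
    by (rule block_T[OF NF])
  also have "N * F * S1 = weighted_weak_group m Z C"
  proof -
    have "N * F * S1 = N * C"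
      using assoc_mult_mat[OF N F c(3)] by (simp add: FS C_def)
    also have "\<dots> = weighted_pow Z X (m + 1) * Z * ((C * Z) ^\<^sub>m p * C)"
      unfolding N_def pow p by (simp add: mult_assoc_dims d' del: pow_mat.simps)
    also have "(C * Z) ^\<^sub>m p * C = weighted_pow Z C m"
      unfolding p weighted_pow_Suc[OF C Z] by (rule mat_pow_mult_swap[OF C Z])
    finally show ?thesis by (simp add: weighted_weak_group_def X_def)
  qed
  also have "N * F * S2
      = X * (Z * X) ^\<^sub>m m * (Z * C) ^\<^sub>m (m - 1) * (Z * (\<Sigma>\<^sub>1 * L\<^sub>1))"
  proof -
    have "N * F * S2 = N * (\<Sigma>\<^sub>1 * L\<^sub>1)"
      using assoc_mult_mat[OF N F c(4)] by (simp add: FS)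
    also have "\<dots> = X * (Z * X) ^\<^sub>m m * (Z * (C * Z) ^\<^sub>m (m - 1)) * (\<Sigma>\<^sub>1 * L\<^sub>1)"
      unfolding N_def pow by (simp add: mult_assoc_dims d' del: pow_mat.simps)
    also have "Z * (C * Z) ^\<^sub>m (m - 1) = (Z * C) ^\<^sub>m (m - 1) * Z"
      by (rule mat_pow_mult_swap[OF Z C, symmetric])
    finally show ?thesis by (simp add: mult_assoc_dims d' del: pow_mat.simps)
  qed
  finally have 3: "weighted_weak_group m W A =
      T * four_block_mat (weighted_weak_group m Z C)
        (X * (Z * X) ^\<^sub>m m * (Z * C) ^\<^sub>m (m - 1) * (Z * (\<Sigma>\<^sub>1 * L\<^sub>1)))
        (0\<^sub>m (q - r\<^sub>1) r\<^sub>2) (0\<^sub>m (q - r\<^sub>1) (n - r\<^sub>2)) * mat_adjoint S" .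
  show ?thesis using 1 2 3 unfolding Let_def X_def C_def Z_def by blast
qed

end
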